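(* Let $f \in \Gamma_0(\mathbb{R}^n)$ be a sparsity promoting function, let $\alpha,\beta>0$, and let $f_\alpha := f-\mathrm{env}_{\alpha f}$. For any $x \in \mathrm{dom}(f)$, the following statements hold: (i) If $\beta < \alpha$, then $\mathrm{prox}_{\beta f_\alpha}(x)=0$ for $x\in \beta\, \partial f(0)$; (ii) If $\beta = \alpha$, then $\mathrm{prox}_{\beta f_\alpha}(x)=0$ for $x\in \mathrm{ri}(\alpha\, \partial f(0))$; (iii) If $\beta > \alpha$, then $\mathrm{prox}_{\beta f_\alpha}(x)=0$ for $x\in \alpha\, \partial f(0)$.
   Context: Functions on $\mathbb{R}^n$ take values in $(-\infty,+\infty]$; $\|\cdot\|$ is the Euclidean norm and $\langle\cdot,\cdot\rangle$ the standard inner product. $\Gamma(\mathbb{R}^n)$ denotes the proper lower semicontinuous functions, and $\Gamma_0(\mathbb{R}^n)$ the proper lower semicontinuous convex functions. For $f\in\Gamma_0(\mathbb{R}^n)$, $\partial f(x)=\{d\in\mathbb{R}^n: f(y)\ge f(x)+\langle d,y-x\rangle\ \forall y\in\mathbb{R}^n\}$ for $x \in \mathrm{dom}(f)$. $\mathrm{ri}(S)$ is the relative interior of $S$. For $g\in\Gamma(\mathbb{R}^n)$ and $\alpha>0$: $\mathrm{env}_{\alpha g}(x)=\inf_{u\in\mathbb{R}^n}\{g(u)+\frac{1}{2\alpha}\|u-x\|^2\}$, and $\mathrm{prox}_{\alpha g}(x)=\mathrm{argmin}_{u\in\mathbb{R}^n}\{g(u)+\frac{1}{2\alpha}\|u-x\|^2\}$,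 which is a set. Writing $\mathrm{prox}_{\alpha g}(x)=p$ means this set equals the singleton $\{p\}$. A function $f$ is sparsity promoting if (i) $f(0)=0$ and $f$ achieves its global minimum at the origin, and (ii) $\partial f(0)$ contains at least one nonzero element. *)

theory Defs
  imports "HOL-Analysis.Analysis"
begin

definition effective_domain :: "(real^'n \<Rightarrow> ereal) \<Rightarrow> (real^'n) set" where
  "effective_domain f = {x. f x < \<infinity>}"

text \<open>The first conjunct is the requirement that values lie in \<open>(-\<infinity>, +\<infinity>]\<close>.\<close>

definition proper_fun :: "(real^'n \<Rightarrow> ereal) \<Rightarrow> bool" where
  "proper_fun f \<longleftrightarrow> (\<forall>x. f x \<noteq> -\<infinity>) \<and> effective_domain f \<noteq> {}"

definition lsc_fun :: "(real^'n \<Rightarrow> ereal) \<Rightarrow> bool" where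
  "lsc_fun f \<longleftrightarrow> (\<forall>x. f x \<le> Liminf (at x) f)"

text \<open>Convexity of extended-valued functions; only used together with \<^const>\<open>proper_fun\<close>,
  so the right-hand side never has the form \<open>\<infinity> - \<infinity>\<close>.\<close>

definition convex_fun :: "(real^'n \<Rightarrow> ereal) \<Rightarrow> bool" where
  "convex_fun f \<longleftrightarrow> (\<forall>x y. \<forall>t. 0 < t \<and> t < 1 \<longrightarrow>
     f ((1 - t) *\<^sub>R x + t *\<^sub>R y) \<le> ereal (1 - t) * f x + ereal t * f y)"

definition Gamma_lsc :: "(real^'n \<Rightarrow> ereal) set" where
  "Gamma_lsc = {f. proper_fun f \<and> lsc_fun f}"

definition Gamma0 :: "(real^'n \<Rightarrow> ereal) set" where
  "Gamma0 = {f. f \<in> Gamma_lsc \<and> convex_fun f}"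

text \<open>For proper \<open>f\<close> this set is empty whenever \<open>f x = \<infinity>\<close>, so no domain condition on \<open>x\<close>
  is needed.\<close>

definition subdifferential :: "(real^'n \<Rightarrow> ereal) \<Rightarrow> real^'n \<Rightarrow> (real^'n) set" where
  "subdifferential f x = {d. \<forall>y. f y \<ge> f x + ereal (d \<bullet> (y - x))}"

definition moreau_env :: "real \<Rightarrow> (real^'n \<Rightarrow> ereal) \<Rightarrow> real^'n \<Rightarrow> ereal" where
  "moreau_env \<alpha> g x = (INF u. g u + ereal (1 / (2 * \<alpha>) * (norm (u - x))\<^sup>2))"

definition prox :: "real \<Rightarrow> (real^'n \<Rightarrow> ereal) \<Rightarrow> real^'n \<Rightarrow> (real^'n) set" where
  "prox \<alpha> g x =
     {p. is_arg_min (\<lambda>u. g u + ereal (1 / (2 * \<alpha>) * (norm (u - x))\<^sup>2)) (\<lambda>_. True) p}"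

definition sparsity_promoting :: "(real^'n \<Rightarrow> ereal) \<Rightarrow> bool" where
  "sparsity_promoting f \<longleftrightarrow>
     f 0 = 0 \<and> (\<forall>x. f 0 \<le> f x) \<and> (\<exists>d \<in> subdifferential f 0. d \<noteq> 0)"

text \<open>The function \<open>f\<^sub>\<alpha> = f - env\<^bsub>\<alpha>f\<^esub>\<close>. If \<open>f\<close> is bounded below and proper, the envelope is
  finite, so the subtraction is unambiguous (and yields \<open>\<infinity>\<close> exactly where \<open>f\<close> does).\<close>

definition env_diff :: "real \<Rightarrow> (real^'n \<Rightarrow> ereal) \<Rightarrow> real^'n \<Rightarrow> ereal" where
  "env_diff \<alpha> f x = f x - moreau_env \<alpha> f x"

end

theory Submission
  imports Defs
begin

text \<open>
  Write \<open>e = moreau_env \<alpha> f\<close>. Since \<open>f \<ge> 0 = f 0\<close>, the envelope satisfies \<open>e 0 = 0\<close>, so expanding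
  \<open>(norm (u - x))\<^sup>2\<close> turns the claim \<open>prox = {0}\<close> into the strict inequality
  \<open>e u + (u \<bullet> x) / \<beta> < f u + (norm u)\<^sup>2 / (2 * \<beta>)\<close> for all \<open>u \<noteq> 0\<close> with finite \<open>f u\<close>.
  Everything then rests on a good upper bound for \<open>e u\<close>. Evaluating the infimum at the points
  \<open>t *\<^sub>R u\<close> of the segment from \<open>0\<close> to \<open>u\<close> and using convexity gives
  \<open>e u \<le> t * f u + (1 - t)\<^sup>2 * (norm u)\<^sup>2 / (2 * \<alpha>)\<close> for every \<open>t\<close> between \<open>0\<close> and \<open>1\<close>.

  Let \<open>d\<close> be a subgradient at \<open>0\<close>, so \<open>d \<bullet> u \<le> f u\<close>. For \<open>\<beta> < \<alpha>\<close> and \<open>x = \<beta> *\<^sub>R d\<close> the choice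
  \<open>t = 0\<close> suffices, because \<open>1 / (2 * \<alpha>) < 1 / (2 * \<beta>)\<close>. For \<open>\<alpha> < \<beta>\<close> and \<open>x = \<alpha> *\<^sub>R d\<close> the right
  choice is \<open>1 - t = \<alpha> / \<beta>\<close>: then \<open>f u - t * f u\<close> is \<open>f u\<close> scaled by \<open>\<alpha> / \<beta>\<close> and dominates
  \<open>(u \<bullet> x) / \<beta>\<close>, while the quadratic terms leave the positive gap
  \<open>(\<alpha> / \<beta>) * (1 - \<alpha> / \<beta>) * (norm u)\<^sup>2 / (2 * \<alpha>)\<close>.

  For \<open>\<beta> = \<alpha>\<close> the choice \<open>t = 0\<close> only gives the inequality in its weak form, and equality forces
  \<open>f u = d \<bullet> u\<close>. This is where the relative interior enters: \<open>0\<close> is a subgradient, as \<open>f\<close> is minimal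
  at \<open>0\<close>, so \<open>c *\<^sub>R d\<close> is still a subgradient for some \<open>c > 1\<close>. Hence \<open>f u \<ge> c * (d \<bullet> u)\<close>, which
  together with \<open>f u = d \<bullet> u\<close> and \<open>f u \<ge> 0\<close> leaves only \<open>f u = 0\<close>. But then \<open>t = 1\<close> gives
  \<open>e u \<le> 0\<close>, and the term \<open>(norm u)\<^sup>2 / (2 * \<alpha>)\<close> makes the inequality strict after all.
\<close>

lemma moreau_env_nonneg:
  fixes g :: "real^'n \<Rightarrow> ereal"
  assumes "\<And>u. 0 \<le> g u" and "\<alpha> > 0"
  shows "0 \<le> moreau_env \<alpha> g x"
  unfolding moreau_env_def using assms by (intro INF_greatest add_nonneg_nonneg) auto

lemma moreau_env_le:
  fixes g :: "real^'n \<Rightarrow> ereal"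
  shows "moreau_env \<alpha> g x \<le> g u + ereal (1 / (2 * \<alpha>) * (norm (u - x))\<^sup>2)"
  unfolding moreau_env_def by (rule INF_lower) simp

text \<open>The bound uses the envelope's competitor \<open>t *\<^sub>R u\<close>, where convexity and \<open>f 0 = 0\<close> give
  \<open>f (t *\<^sub>R u) \<le> t * r\<close>. The free parameter \<open>t\<close> lets each of the three regimes trade the value
  term against the quadratic one.\<close>

lemma moreau_env_le_segment:
  fixes f :: "real^'n \<Rightarrow> ereal"
  assumes "convex_fun f" and "f 0 = 0" and "f u = ereal r" and "0 \<le> t" and "t \<le> 1"
  shows "moreau_env \<alpha> f u \<le> ereal (t * r + (1 - t)\<^sup>2 * (norm u)\<^sup>2 / (2 * \<alpha>))"
proof -
  have "f (t *\<^sub>R u) \<le> ereal (t * r)"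
  proof (cases "t = 0 \<or> t = 1")
    case False
    then have "f ((1 - t) *\<^sub>R 0 + t *\<^sub>R u) \<le> ereal (1 - t) * f 0 + ereal t * f u"
      using assms(1,4,5) unfolding convex_fun_def by (metis order_le_less)
    then show ?thesis using assms by simp
  qed (use assms in \<open>auto simp: zero_ereal_def\<close>)
  then have "f (t *\<^sub>R u) + ereal (1 / (2 * \<alpha>) * (norm (t *\<^sub>R u - u))\<^sup>2)
      \<le> ereal (t * r) + ereal (1 / (2 * \<alpha>) * (norm (t *\<^sub>R u - u))\<^sup>2)"
    by (rule add_right_mono)
  moreover have "(norm (t *\<^sub>R u - u))\<^sup>2 = (1 - t)\<^sup>2 * (norm u)\<^sup>2"
  proof -
    have "t *\<^sub>R u - u = (t - 1) *\<^sub>R u" by (simp add: algebra_simps)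
    then have "(norm (t *\<^sub>R u - u))\<^sup>2 = (t - 1)\<^sup>2 * (norm u)\<^sup>2"
      by (simp add: power_mult_distrib)
    then show ?thesis by (simp add: power2_commute)
  qed
  ultimately show ?thesis
    using moreau_env_le[of \<alpha> f u "t *\<^sub>R u"] by (auto intro: order_trans)
qed

text \<open>The value of the objective at \<open>0\<close> is \<open>(norm x)\<^sup>2 / (2 * \<beta>)\<close>. Points with \<open>f u = \<infinity>\<close> cannot
  compete, because the envelope stays finite there; elsewhere the claim becomes an inequality
  between real numbers.\<close>

lemma prox_env_diff_eq_0:
  fixes f :: "real^'n \<Rightarrow> ereal"
  assumes nonneg: "\<And>u. 0 \<le> f u" and f0: "f 0 = 0" and \<alpha>: "\<alpha> > 0" and \<beta>: "\<beta> > 0"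
    and gap: "\<And>u r m. \<lbrakk>u \<noteq> 0; f u = ereal r; moreau_env \<alpha> f u = ereal m\<rbrakk>
      \<Longrightarrow> m + (u \<bullet> x) / \<beta> < r + (norm u)\<^sup>2 / (2 * \<beta>)"
  shows "prox \<beta> (env_diff \<alpha> f) x = {0}"
proof -
  define F where "F = (\<lambda>u. env_diff \<alpha> f u + ereal (1 / (2 * \<beta>) * (norm (u - x))\<^sup>2))"
  have "moreau_env \<alpha> f 0 = 0"
    using moreau_env_le[of \<alpha> f 0 0] moreau_env_nonneg[of f \<alpha> 0, OF nonneg \<alpha>] f0
    by (simp add: order_antisym flip: zero_ereal_def)
  then have F0: "F 0 = ereal ((norm x)\<^sup>2 / (2 * \<beta>))"
    by (simp add: F_def env_diff_def f0)
  have less: "F 0 < F u" if "u \<noteq> 0" for u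
  proof -
    have "moreau_env \<alpha> f u \<noteq> \<infinity>"
      using moreau_env_le[of \<alpha> f u 0] f0 by auto
    with moreau_env_nonneg[of f \<alpha> u, OF nonneg \<alpha>] obtain m where m: "moreau_env \<alpha> f u = ereal m"
      by (cases "moreau_env \<alpha> f u") auto
    show ?thesis
    proof (cases "f u")
      case (real r)
      have "(norm (u - x))\<^sup>2 = (norm u)\<^sup>2 - 2 * (u \<bullet> x) + (norm x)\<^sup>2"
        by (simp add: power2_norm_eq_inner inner_diff inner_commute)
      then have "1 / (2 * \<beta>) * (norm (u - x))\<^sup>2
          = (norm u)\<^sup>2 / (2 * \<beta>) - (u \<bullet> x) / \<beta> + (norm x)\<^sup>2 / (2 * \<beta>)"
        using \<beta> by (simp add: field_simps)
      then show ?thesis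
        using gap[OF that real m] by (simp add: F0) (simp add: F_def env_diff_def real m)
    next
      case PInf
      then have "F u = \<infinity>" by (simp add: F_def env_diff_def m)
      then show ?thesis by (simp add: F0)
    next
      case MInf
      then show ?thesis using nonneg[of u] by simp
    qed
  qed
  have "is_arg_min F (\<lambda>_. True) p \<longleftrightarrow> p = 0" for p
    unfolding is_arg_min_def using less by (metis less_asym)
  then show ?thesis
    by (simp add: prox_def F_def)
qed

text \<open>As an intersection of half-spaces, one for each point where \<open>f\<close> is finite.\<close>

lemma convex_subdifferential_0:
  fixes f :: "real^'n \<Rightarrow> ereal"
  assumes nonneg: "\<And>u. 0 \<le> f u" and f0: "f 0 = 0"
  shows "convex (subdifferential f 0)"
proof -
  have "subdifferential f 0 = (\<Inter>y\<in>effective_domain f. {d. y \<bullet> d \<le> real_of_ereal (f y)})"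
  proof -
    have "ereal (d \<bullet> y) \<le> f y \<longleftrightarrow> (f y < \<infinity> \<longrightarrow> y \<bullet> d \<le> real_of_ereal (f y))" for d y
      using nonneg[of y] by (cases "f y") (auto simp: inner_commute)
    then show ?thesis
      by (auto simp: subdifferential_def effective_domain_def f0)
  qed
  then show ?thesis
    by (simp add: convex_INT convex_halfspace_le)
qed

theorem theorem2:
  fixes f :: "real^'n \<Rightarrow> ereal" and \<alpha> \<beta> :: real and x :: "real^'n"
  assumes "f \<in> Gamma0"
    and "sparsity_promoting f"
    and "\<alpha> > 0" and "\<beta> > 0"
    and "x \<in> effective_domain f"
  shows "(\<beta> < \<alpha> \<longrightarrow> x \<in> (*\<^sub>R) \<beta> ` subdifferential f 0 \<longrightarrow>
            prox \<beta> (env_diff \<alpha> f) x = {0})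
       \<and> (\<beta> = \<alpha> \<longrightarrow> x \<in> rel_interior ((*\<^sub>R) \<alpha> ` subdifferential f 0) \<longrightarrow>
            prox \<beta> (env_diff \<alpha> f) x = {0})
       \<and> (\<beta> > \<alpha> \<longrightarrow> x \<in> (*\<^sub>R) \<alpha> ` subdifferential f 0 \<longrightarrow>
            prox \<beta> (env_diff \<alpha> f) x = {0})"
proof (intro conjI impI)
  note \<alpha> = \<open>\<alpha> > 0\<close> and \<beta> = \<open>\<beta> > 0\<close>
  have conv: "convex_fun f" using assms(1) by (simp add: Gamma0_def)
  have f0: "f 0 = 0" and nonneg: "\<And>u. 0 \<le> f u"
    using assms(2) by (auto simp: sparsity_promoting_def)
  have subgradient: "d \<bullet> u \<le> r" if "d \<in> subdifferential f 0" "f u = ereal r" for d u r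
  proof -
    have "f u \<ge> f 0 + ereal (d \<bullet> (u - 0))"
      using that(1) unfolding subdifferential_def by blast
    then show ?thesis using that(2) f0 by simp
  qed
  have segment: "m \<le> t * r + (1 - t)\<^sup>2 * (norm u)\<^sup>2 / (2 * \<alpha>)"
    if "f u = ereal r" "moreau_env \<alpha> f u = ereal m" "0 \<le> t" "t \<le> 1" for u r m t
    using moreau_env_le_segment[OF conv f0 that(1,3,4), of \<alpha>] that(2) by simp
  {
    assume less: "\<beta> < \<alpha>" and "x \<in> (*\<^sub>R) \<beta> ` subdifferential f 0"
    then obtain d where d: "d \<in> subdifferential f 0" and x: "x = \<beta> *\<^sub>R d" by blast
    show "prox \<beta> (env_diff \<alpha> f) x = {0}"
    proof (rule prox_env_diff_eq_0[of f, OF nonneg f0 \<alpha> \<beta>])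
      fix u r m assume u: "u \<noteq> 0" "f u = ereal r" "moreau_env \<alpha> f u = ereal m"
      have "m \<le> (norm u)\<^sup>2 / (2 * \<alpha>)" using segment[OF u(2,3), of 0] by simp
      also have "\<dots> < (norm u)\<^sup>2 / (2 * \<beta>)"
        using less \<beta> u(1) by (intro divide_strict_left_mono) auto
      finally show "m + (u \<bullet> x) / \<beta> < r + (norm u)\<^sup>2 / (2 * \<beta>)"
        using subgradient[OF d u(2)] \<beta> by (simp add: x inner_commute)
    qed
  }
  {
    assume eq: "\<beta> = \<alpha>" and ri: "x \<in> rel_interior ((*\<^sub>R) \<alpha> ` subdifferential f 0)"
    then obtain d where d: "d \<in> subdifferential f 0" and x: "x = \<alpha> *\<^sub>R d"
      using rel_interior_subset by blast
    have "0 \<in> subdifferential f 0"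
      using nonneg by (simp add: subdifferential_def f0 flip: zero_ereal_def)
    then have "0 \<in> (*\<^sub>R) \<alpha> ` subdifferential f 0"
      by force
    moreover have "convex ((*\<^sub>R) \<alpha> ` subdifferential f 0)"
      by (intro convex_scaling convex_subdifferential_0 nonneg f0)
    \<comment> \<open>The segment from the subgradient \<open>0\<close> to \<open>d\<close> can be prolonged beyond \<open>d\<close>.\<close>
    ultimately obtain c where c: "c > 1" "c *\<^sub>R x \<in> (*\<^sub>R) \<alpha> ` subdifferential f 0"
      using convex_rel_interior_if[OF _ ri] by (force intro: hull_inc)
    then have cd: "c *\<^sub>R d \<in> subdifferential f 0"
      using \<alpha> by (auto simp: x scaleR_left_commute[of c] simp del: scaleR_scaleR)
    show "prox \<beta> (env_diff \<alpha> f) x = {0}"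
    proof (rule prox_env_diff_eq_0[of f, OF nonneg f0 \<alpha> \<beta>])
      fix u r m assume u: "u \<noteq> 0" "f u = ereal r" "moreau_env \<alpha> f u = ereal m"
      have "m + d \<bullet> u < r + (norm u)\<^sup>2 / (2 * \<alpha>)"
      proof (cases "d \<bullet> u < r")
        case True
        then show ?thesis using segment[OF u(2,3), of 0] by simp
      next
        case False
        then have r: "r = d \<bullet> u" using subgradient[OF d u(2)] by simp
        have "c * r \<le> r" using subgradient[OF cd u(2)] r by simp
        then have "(c - 1) * r \<le> 0" by (simp add: algebra_simps)
        then have "r \<le> 0" using c(1) by (simp add: mult_le_0_iff)
        moreover have "m \<le> r" using segment[OF u(2,3), of 1] by simp
        moreover have "0 < (norm u)\<^sup>2 / (2 * \<alpha>)" using u(1) \<alpha> by simp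
        ultimately show ?thesis using r by linarith
      qed
      then show "m + (u \<bullet> x) / \<beta> < r + (norm u)\<^sup>2 / (2 * \<beta>)"
        using \<alpha> by (simp add: x eq inner_commute)
    qed
  }
  {
    assume less: "\<beta> > \<alpha>" and "x \<in> (*\<^sub>R) \<alpha> ` subdifferential f 0"
    then obtain d where d: "d \<in> subdifferential f 0" and x: "x = \<alpha> *\<^sub>R d" by blast
    \<comment> \<open>The envelope is tested at the point \<open>(1 - s) *\<^sub>R u\<close>, so that \<open>f u\<close> survives with weight \<open>s\<close>,
      exactly the factor of \<open>d \<bullet> u\<close> in \<open>(u \<bullet> x) / \<beta>\<close>.\<close>
    define s where "s = \<alpha> / \<beta>"
    have s: "0 < s" "s < 1" using less \<alpha> \<beta> by (auto simp: s_def)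
    show "prox \<beta> (env_diff \<alpha> f) x = {0}"
    proof (rule prox_env_diff_eq_0[of f, OF nonneg f0 \<alpha> \<beta>])
      fix u r m assume u: "u \<noteq> 0" "f u = ereal r" "moreau_env \<alpha> f u = ereal m"
      have "m \<le> (1 - s) * r + s\<^sup>2 * ((norm u)\<^sup>2 / (2 * \<alpha>))"
        using segment[OF u(2,3), of "1 - s"] s by simp
      moreover have "s * (d \<bullet> u) \<le> s * r"
        using subgradient[OF d u(2)] s by simp
      moreover have "s\<^sup>2 * ((norm u)\<^sup>2 / (2 * \<alpha>)) < s * ((norm u)\<^sup>2 / (2 * \<alpha>))"
        using s u(1) \<alpha> by (intro mult_strict_right_mono) (auto simp: power2_eq_square)
      moreover have "s * ((norm u)\<^sup>2 / (2 * \<alpha>)) = (norm u)\<^sup>2 / (2 * \<beta>)"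
        using \<alpha> by (simp add: s_def)
      moreover have "(u \<bullet> x) / \<beta> = s * (d \<bullet> u)"
        by (simp add: x s_def inner_commute)
      ultimately show "m + (u \<bullet> x) / \<beta> < r + (norm u)\<^sup>2 / (2 * \<beta>)"
        by (simp add: algebra_simps)
    qed
  }
qed

end
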